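(* Consider the Pareto model with parameter set $\Theta=(1,\infty)$, and let $k>0$ be fixed and $\gamma=1$. Let $(\beta_N)_{N\ge 1}$ be a sequence of tail probabilities in $(0,1)$ such that, for some $\eta>0$, $\beta_N^{-1}=o(N^{1-\eta})$ as $N\to\infty$. Then the DR-expected shortfall $(\mathcal{E}^{k,1}_{\mathcal{Q}|\mathbf{x}_N}\circ \mathrm{ES}_{\beta_N})(X)$ is regularizable.
   Context: Pareto model: $X, X_1,X_2,\dots$ are real random variables and $\mathcal{Q}=\{Q_\theta:\theta\in\Theta\}$ is the family of measures under which they are iid with density $f(x;\theta)=\theta x^{-(1+\theta)}$ for $x>1$. Here $\Theta=(1,\infty)$. Write $\mathbf{x}_N=(X_1,\dots,X_N)$, $\ell(\mathbf{x}_N;\theta)=\sum_{i=1}^N\log f(X_i;\theta)$, and define the divergence $\alpha_{\mathcal{Q}|\mathbf{x}_N}(\theta)=\sup_{\theta'\in\Theta}\ell(\mathbf{x}_N;\theta')-\ell(\mathbf{x}_N;\theta)$. For $\delta\in\mathbb{R}$, the $\delta$-truncation is $\alpha^{(\delta)}_{\mathcal{Q}|\mathbf{x}_N}(\theta)=\alpha_{\mathcal{Q}|\mathbf{x}_N}(\theta)$ if $\alpha_{\mathcal{Q}|\mathbf{x}_N}(\theta)\le N^\delta$ and $+\infty$ otherwise. For a risk assessment $\mathcal{R}$ (a map from laws on $\mathbb{R}$ to values in $(-\infty,\infty]$), write $\mathcal{R}_\theta$ for its value on the law of $X$ under $Q_\theta$. For $k>0$ and $\gamma\in[1,\infty)$,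 put $$(\mathcal{E}^{k,\gamma,\delta}_{\mathcal{Q}|\mathbf{x}_N}\circ\mathcal{R})(X)=\sup_{\theta\in\Theta}\Big\{\mathcal{R}_\theta-\Big(\tfrac1k\alpha^{(\delta)}_{\mathcal{Q}|\mathbf{x}_N}(\theta)\Big)^\gamma\Big\},$$ where parameters with infinite penalty are excluded from the supremum. This quantity is called regular (for given observations $\mathbf{x}_N$) if the supremum is finite and attained at a point $\theta$ with $\alpha_{\mathcal{Q}|\mathbf{x}_N}(\theta)<N^\delta$. For a sequence $(\mathcal{R}_N)$ of risk assessments, $(\mathcal{E}^{k,\gamma}_{\mathcal{Q}|\mathbf{x}_N}\circ\mathcal{R}_N)(X)$ is called regularizable if there exists $\delta>0$ such that, for every $P\in\mathcal{Q}$, with $P$-probability tending to $1$ as $N\to\infty$, $(\mathcal{E}^{k,\gamma,\delta}_{\mathcal{Q}|\mathbf{x}_N}\circ\mathcal{R}_N)(X)$ is regular. The expected shortfall with tail probability $\beta\in(0,1)$ under $Q_\theta$ is $\mathrm{ES}_\beta=E_{Q_\theta}[X\mid X\ge F_\theta^{-1}(1-\beta)]$, where $F_\theta$ is the cdf of $X$ under $Q_\theta$; in this model it equals $\frac{\theta}{\theta-1}\beta^{-1/\theta}$. *)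

theory Defs
  imports "HOL-Probability.Probability" "HOL-Library.Landau_Symbols"
begin

text \<open>
  One measurable space carries all the measures \<open>Q \<theta>\<close>. The variable \<open>X 0\<close> is the future
  quantity \<open>X\<close> whose risk is assessed; \<open>X 1, X 2, \<dots>\<close> are the observations.
\<close>

locale iid_density_model =
  fixes \<Theta> :: "real set"
    and f :: "real \<Rightarrow> real \<Rightarrow> real"  \<comment> \<open>\<open>f x \<theta>\<close> is the density at \<open>x\<close> under \<open>\<theta>\<close>\<close>
    and Q :: "real \<Rightarrow> 'w measure"
    and X :: "nat \<Rightarrow> 'w \<Rightarrow> real"
  assumes prob_space_Q: "\<theta> \<in> \<Theta> \<Longrightarrow> prob_space (Q \<theta>)"
    and sets_Q: "\<theta> \<in> \<Theta> \<Longrightarrow> \<theta>' \<in> \<Theta> \<Longrightarrow> sets (Q \<theta>) = sets (Q \<theta>')"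
    and indep_X: "\<theta> \<in> \<Theta> \<Longrightarrow> prob_space.indep_vars (Q \<theta>) (\<lambda>_. borel) X UNIV"
    and distributed_X:
      "\<theta> \<in> \<Theta> \<Longrightarrow> distributed (Q \<theta>) lborel (X i) (\<lambda>x. ennreal (f x \<theta>))"

definition pareto_density :: "real \<Rightarrow> real \<Rightarrow> real" where
  "pareto_density x \<theta> = (if x > 1 then \<theta> * x powr (- (1 + \<theta>)) else 0)"

text \<open>The logarithm with \<open>log 0 = -\<infinity>\<close>; \<^term>\<open>ln (0::real)\<close> is \<open>0\<close>.\<close>

definition elog :: "real \<Rightarrow> ereal" where
  "elog y = (if y > 0 then ereal (ln y) else - \<infinity>)"

definition loglik :: "(real \<Rightarrow> real \<Rightarrow> real) \<Rightarrow> nat \<Rightarrow> (nat \<Rightarrow> real) \<Rightarrow> real \<Rightarrow> ereal" where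
  "loglik f N x \<theta> = (\<Sum>i=1..N. elog (f (x i) \<theta>))"

text \<open>
  If every parameter has likelihood zero, the difference below is \<open>-\<infinity> - (-\<infinity>) = \<infinity>\<close> in
  \<^typ>\<open>ereal\<close>, so that no parameter is admissible. In the Pareto model this happens only on
  the null event that some observation is at most 1.
\<close>

definition divergence ::
    "real set \<Rightarrow> (real \<Rightarrow> real \<Rightarrow> real) \<Rightarrow> nat \<Rightarrow> (nat \<Rightarrow> real) \<Rightarrow> real \<Rightarrow> ereal" where
  "divergence \<Theta> f N x \<theta> = (SUP \<theta>'\<in>\<Theta>. loglik f N x \<theta>') - loglik f N x \<theta>"

definition trunc_divergence ::
    "real set \<Rightarrow> (real \<Rightarrow> real \<Rightarrow> real) \<Rightarrow> real \<Rightarrow> nat \<Rightarrow> (nat \<Rightarrow> real) \<Rightarrow> real \<Rightarrow> ereal" where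
  "trunc_divergence \<Theta> f \<delta> N x \<theta> =
     (if divergence \<Theta> f N x \<theta> \<le> ereal (real N powr \<delta>) then divergence \<Theta> f N x \<theta> else \<infinity>)"

text \<open>
  Below, \<open>r \<theta>\<close> stands for the value of the risk assessment on the law of \<open>X\<close> under
  \<open>Q \<theta>\<close>, and \<open>x i\<close> for the \<open>i\<close>-th observed value. The objective is only
  meaningful for \<open>\<theta>\<close> with finite penalty.
\<close>

definition DR_objective ::
    "real set \<Rightarrow> (real \<Rightarrow> real \<Rightarrow> real) \<Rightarrow> real \<Rightarrow> real \<Rightarrow> real \<Rightarrow> (real \<Rightarrow> ereal) \<Rightarrow>
     nat \<Rightarrow> (nat \<Rightarrow> real) \<Rightarrow> real \<Rightarrow> ereal" where
  "DR_objective \<Theta> f k \<gamma> \<delta> r N x \<theta> =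
     r \<theta> - ereal ((1 / k * real_of_ereal (trunc_divergence \<Theta> f \<delta> N x \<theta>)) powr \<gamma>)"

definition DR_expectation ::
    "real set \<Rightarrow> (real \<Rightarrow> real \<Rightarrow> real) \<Rightarrow> real \<Rightarrow> real \<Rightarrow> real \<Rightarrow> (real \<Rightarrow> ereal) \<Rightarrow>
     nat \<Rightarrow> (nat \<Rightarrow> real) \<Rightarrow> ereal" where
  "DR_expectation \<Theta> f k \<gamma> \<delta> r N x =
     (SUP \<theta> \<in> {\<theta> \<in> \<Theta>. trunc_divergence \<Theta> f \<delta> N x \<theta> < \<infinity>}. DR_objective \<Theta> f k \<gamma> \<delta> r N x \<theta>)"

definition regular ::
    "real set \<Rightarrow> (real \<Rightarrow> real \<Rightarrow> real) \<Rightarrow> real \<Rightarrow> real \<Rightarrow> real \<Rightarrow> (real \<Rightarrow> ereal) \<Rightarrow>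
     nat \<Rightarrow> (nat \<Rightarrow> real) \<Rightarrow> bool" where
  "regular \<Theta> f k \<gamma> \<delta> r N x \<longleftrightarrow>
     \<bar>DR_expectation \<Theta> f k \<gamma> \<delta> r N x\<bar> \<noteq> \<infinity> \<and>
     (\<exists>\<theta>\<in>\<Theta>. divergence \<Theta> f N x \<theta> < ereal (real N powr \<delta>) \<and>
        DR_objective \<Theta> f k \<gamma> \<delta> r N x \<theta> = DR_expectation \<Theta> f k \<gamma> \<delta> r N x)"

definition regularizable ::
    "real set \<Rightarrow> (real \<Rightarrow> real \<Rightarrow> real) \<Rightarrow> (real \<Rightarrow> 'w measure) \<Rightarrow> (nat \<Rightarrow> 'w \<Rightarrow> real) \<Rightarrow>
     real \<Rightarrow> real \<Rightarrow> (nat \<Rightarrow> real measure \<Rightarrow> ereal) \<Rightarrow> bool" where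
  "regularizable \<Theta> f Q X k \<gamma> R \<longleftrightarrow>
     (\<exists>\<delta>>0. \<forall>\<theta>\<^sub>0\<in>\<Theta>.
        (\<lambda>N. measure (Q \<theta>\<^sub>0)
               {\<omega> \<in> space (Q \<theta>\<^sub>0).
                  regular \<Theta> f k \<gamma> \<delta> (\<lambda>\<theta>. R N (distr (Q \<theta>) borel (X 0))) N (\<lambda>i. X i \<omega>)})
        \<longlonglongrightarrow> 1)"

definition quantile :: "real measure \<Rightarrow> real \<Rightarrow> real" where
  "quantile M u = Inf {x. u \<le> cdf M x}"

text \<open>
  The mean of \<open>M\<close> conditioned on the tail above the quantile. The tail is bounded below, so
  the conditional mean is \<open>\<infinity>\<close> whenever it is not finite.
\<close>

definition expected_shortfall :: "real \<Rightarrow> real measure \<Rightarrow> ereal" where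
  "expected_shortfall \<beta> M =
     (let C = uniform_measure M {quantile M (1 - \<beta>)..}
      in if integrable C (\<lambda>x. x) then ereal (\<integral>x. x \<partial>C) else \<infinity>)"

end

theory Submission
  imports Defs
begin

text \<open>
  Let \<open>T\<close> be the mean of the \<open>ln (X i)\<close> and \<open>h u = u - 1 - ln u\<close>. When \<open>T < 1\<close> the maximum
  likelihood estimator is \<open>1 / T\<close>, and in the variable \<open>u = \<theta> * T\<close> the divergence is
  \<open>N * h u\<close>, so that the admissible \<open>u\<close> do not depend on \<open>T\<close>. If \<open>u = T\<close> (that is,
  \<open>\<theta> = 1\<close>) is inadmissible, the admissible set is compact, and the maximum is attained in the
  interior unless the lower end of the set wins. The truncation level \<open>N powr \<delta>\<close> with
  \<open>max 0 (1 - \<eta>) < \<delta> < 1\<close> is \<open>o(N)\<close>, so it eventually excludes \<open>\<theta> = 1\<close>; it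
  also dominates the expected shortfall, which near the estimator is at most a constant times
  \<open>1 / \<beta> N\<close>, so that the lower end loses. By the weak law of large numbers \<open>T\<close> stays below
  some \<open>t < 1\<close> with probability tending to 1.

  The set of all \<open>T\<close> with a regular outcome has to be Borel, since \<^const>\<open>measure\<close>
  vanishes on nonmeasurable sets. In fact it is an interval: the advantage of the lower end
  over any other \<open>u\<close> increases with \<open>T\<close>.
\<close>

text \<open>The expected shortfall at tail probability \<open>b\<close> for \<open>\<theta> = 1 / p\<close>.\<close>

definition pareto_es :: "real \<Rightarrow> real \<Rightarrow> real" where
  "pareto_es b p = b powr (- p) / (1 - p)"

text \<open>The Kullback-Leibler divergence of the exponential law with rate 1 relative to that with
  rate \<open>u\<close>; it is \<open>h\<close> in the overview.\<close>

definition deviance :: "real \<Rightarrow> real" where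
  "deviance u = u - 1 - ln u"

text \<open>The objective at \<open>\<theta> = u / T\<close>.\<close>

definition penalized_es :: "real \<Rightarrow> real \<Rightarrow> real \<Rightarrow> real \<Rightarrow> real \<Rightarrow> real" where
  "penalized_es k n b T u = pareto_es b (T / u) - n * deviance u / k"

text \<open>The means \<open>T\<close> with a regular outcome, in the variable
  \<open>u = \<theta> * T\<close>: the bound \<open>u > T\<close> encodes
  \<open>\<theta> > 1\<close>, and \<open>a\<close> is the truncation level.\<close>

definition interior_max_set :: "real \<Rightarrow> real \<Rightarrow> real \<Rightarrow> real \<Rightarrow> real set" where
  "interior_max_set k n a b =
     {T. 0 < T \<and> T < 1 \<and> (\<exists>u>T. n * deviance u < a \<and>
        (\<forall>v>T. n * deviance v \<le> a \<longrightarrow> penalized_es k n b T v \<le> penalized_es k n b T u))}"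

section \<open>Growth of the expected shortfall in \<open>p = 1 / \<theta>\<close>\<close>

lemma pareto_es_ge:
  assumes "0 < b" "b < 1" "0 \<le> p" "p < 1"
  shows "1 / (1 - p) \<le> pareto_es b p"
proof -
  have "1 \<le> b powr (- p)"
    using assms powr_mono'[of "-p" 0 b] by simp
  then show ?thesis
    using assms by (simp add: pareto_es_def divide_right_mono)
qed

lemma pareto_es_nonneg: "p < 1 \<Longrightarrow> 0 \<le> pareto_es b p"
  by (simp add: pareto_es_def)

lemma pareto_es_mono:
  assumes "0 < b" "b < 1" "p \<le> q" "q < 1"
  shows "pareto_es b p \<le> pareto_es b q"
  unfolding pareto_es_def using assms by (intro frac_le powr_mono') auto

text \<open>The factor \<open>1 / (1 - p)\<close> blows up at \<open>p = 1\<close>, that is, as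
  \<open>\<theta>\<close> tends to 1. This rules out a maximum whenever parameters near 1 are
  admissible.\<close>

lemma pareto_es_unbounded:
  assumes "0 < b" "b < 1" "p0 < 1"
  shows "\<exists>p>p0. p < 1 \<and> 0 < p \<and> C < pareto_es b p"
proof -
  define c where "c = max 0 (max p0 (1 - 1 / (\<bar>C\<bar> + 1)))"
  have "0 < 1 / (\<bar>C\<bar> + 1)" by (simp add: add_nonneg_pos)
  then have "c < 1" using assms by (simp add: c_def)
  then obtain p where p: "c < p" "p < 1"
    using dense[of c 1] \<open>c < 1\<close> by blast
  have "0 < p" "p0 < p" "1 - 1 / (\<bar>C\<bar> + 1) < p"
    using p by (auto simp: c_def)
  then have "1 - p < 1 / (\<bar>C\<bar> + 1)" by simp
  then have "\<bar>C\<bar> + 1 < 1 / (1 - p)"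
    using p by (simp add: field_simps)
  also have "\<dots> \<le> pareto_es b p"
    using pareto_es_ge[of b p] assms p \<open>0 < p\<close> by simp
  finally show ?thesis
    using p \<open>0 < p\<close> \<open>p0 < p\<close> by (intro exI[of _ p]) auto
qed

lemma pareto_es_has_derivative:
  assumes "0 < b" "p < 1"
  shows "(pareto_es b has_real_derivative
           b powr (- p) * (- ln b / (1 - p) + 1 / (1 - p)\<^sup>2)) (at p)"
proof -
  have eq: "pareto_es b = (\<lambda>p. exp (- p * ln b) / (1 - p))"
    using assms by (auto simp: fun_eq_iff pareto_es_def powr_def)
  show ?thesis
    unfolding eq using assms
    by (auto intro!: derivative_eq_intros simp: powr_def power2_eq_square divide_simps)
       (simp add: algebra_simps)
qed

text \<open>Holds because the power series of \<^term>\<open>pareto_es b\<close> has nonnegative coefficients.\<close>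

lemma pareto_es_diff_scale_mono:
  assumes b: "0 < b" "b < 1" and xy: "0 \<le> x" "x \<le> y" and st: "s \<le> t" "0 \<le> s" "t * y < 1"
  shows "pareto_es b (s * y) - pareto_es b (s * x) \<le> pareto_es b (t * y) - pareto_es b (t * x)"
proof -
  define E where "E p = - ln b / (1 - p) + 1 / (1 - p)\<^sup>2" for p
  define D where "D p = b powr (- p) * E p" for p
  have ln_b: "0 \<le> - ln b" using b by simp
  have E_nn: "0 \<le> E p" if "p < 1" for p
    unfolding E_def using ln_b that by (intro add_nonneg_nonneg divide_nonneg_nonneg) auto
  have E_mono: "E p \<le> E q" if "p \<le> q" "q < 1" for p q
    unfolding E_def using ln_b that
    by (intro add_mono divide_left_mono power_mono mult_pos_pos zero_less_power) auto
  have D_mono: "D p \<le> D q" if "p \<le> q" "q < 1" for p q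
    unfolding D_def using b that E_nn[of q] E_nn[of p]
    by (intro mult_mono powr_mono' E_mono) auto
  show ?thesis
  \<comment> \<open>\<open>D\<close> is the derivative of \<open>pareto_es b\<close>. It is
    nonnegative and increasing below 1, so the derivative
    \<open>D (r * y) * y - D (r * x) * x\<close> in the scale \<open>r\<close> is
    nonnegative.\<close>
  proof (rule DERIV_nonneg_imp_nondecreasing[OF st(1)])
    fix r assume r: "s \<le> r" "r \<le> t"
    have "r * y \<le> t * y" using r xy by (intro mult_right_mono) auto
    then have ry: "r * y < 1" using st by simp
    have rxy: "r * x \<le> r * y" using r st xy by (intro mult_left_mono) auto
    have D_le: "D (r * x) \<le> D (r * y)"
      by (intro D_mono rxy ry)
    have D_nn: "0 \<le> D (r * y)"
      unfolding D_def using E_nn ry by simp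
    have comp: "((\<lambda>r. pareto_es b (r * z)) has_real_derivative D (r * z) * z) (at r)"
      if "r * z < 1" for z
      unfolding D_def E_def
      by (rule DERIV_chain2[where g = "\<lambda>r. r * z", OF pareto_es_has_derivative[OF b(1) that]])
         (auto intro!: derivative_eq_intros)
    have "((\<lambda>r. pareto_es b (r * y) - pareto_es b (r * x)) has_real_derivative
            D (r * y) * y - D (r * x) * x) (at r)"
      using ry rxy by (intro DERIV_diff comp) auto
    moreover have "D (r * x) * x \<le> D (r * y) * x"
      using D_le xy by (intro mult_right_mono) auto
    moreover have "D (r * y) * x \<le> D (r * y) * y"
      using D_nn xy by (intro mult_left_mono) auto
    ultimately show "\<exists>d. ((\<lambda>r. pareto_es b (r * y) - pareto_es b (r * x)) has_real_derivative d) (at r)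
        \<and> 0 \<le> d"
      by (intro exI[of _ "D (r * y) * y - D (r * x) * x"]) auto
  qed
qed

section \<open>The deviance\<close>

lemma deviance_1 [simp]: "deviance 1 = 0"
  by (simp add: deviance_def)

lemma deviance_nonneg: "0 < u \<Longrightarrow> 0 \<le> deviance u"
  using ln_le_minus_one[of u] by (simp add: deviance_def)

lemma deviance_strict_antimono:
  assumes "0 < u" "u < v" "v \<le> 1"
  shows "deviance v < deviance u"
proof -
  have "ln (u / v) \<le> u / v - 1" using assms by (intro ln_le_minus_one) auto
  then have le: "ln u - ln v \<le> (u - v) / v" using assms by (simp add: ln_div field_simps)
  show ?thesis
  \<comment> \<open>For \<open>v < 1\<close> dividing by \<open>v\<close> makes the bound
    \<open>le\<close> strict; at \<open>v = 1\<close> strictness must come from the logarithm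
    itself.\<close>
  proof (cases "v = 1")
    case False
    have "(v - u) * v < v - u" using assms False by simp
    then have "(u - v) / v < u - v" using assms by (simp add: field_simps)
    with le show ?thesis by (simp add: deviance_def)
  next
    case True
    have "ln u < u - 1" using assms True ln_eq_minus_one[of u] ln_le_minus_one[of u] by force
    with True show ?thesis by (simp add: deviance_def)
  qed
qed

text \<open>Applying the tangent bound of \<open>ln\<close> at \<open>u / 2\<close> leaves a
  positive slope. This linear growth bounds the admissible \<open>u\<close> from above.\<close>

lemma deviance_ge_half: "0 < u \<Longrightarrow> u / 2 - 1 \<le> deviance u"
  using ln_le_minus_one[of "u / 2"] ln_2_less_1 by (simp add: deviance_def ln_div)

section \<open>Interior maxima of the penalized expected shortfall\<close>

text \<open>Moving from \<open>v\<close> down to 1 does not lower the shortfall and removes the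
  penalty. This settles the upper end of the admissible set.\<close>

lemma penalized_es_le_1:
  assumes "0 < b" "b < 1" "0 < k" "0 < n" "0 < T" "T < 1" "1 \<le> v"
  shows "penalized_es k n b T v \<le> penalized_es k n b T 1"
proof -
  have "T / v \<le> T" using assms by (simp add: divide_simps)
  then have "pareto_es b (T / v) \<le> pareto_es b T"
    using assms by (intro pareto_es_mono) auto
  moreover have "0 \<le> n * deviance v / k" using assms deviance_nonneg[of v] by auto
  ultimately show ?thesis by (simp add: penalized_es_def)
qed

text \<open>
  The maximum over the compact set of admissible \<open>u\<close> exists, and its lower end is the only
  boundary point that could compete with the interior.
\<close>

lemma interior_max_setI:
  assumes b: "0 < b" "b < 1" and pos: "0 < k" "0 < n" "0 < a" and T: "0 < T" "T < 1"
    and far: "a < n * deviance T"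
    and boundary: "\<And>w. T < w \<Longrightarrow> w < 1 \<Longrightarrow> n * deviance w = a \<Longrightarrow>
      \<exists>u>T. n * deviance u < a \<and> penalized_es k n b T w \<le> penalized_es k n b T u"
  shows "T \<in> interior_max_set k n a b"
proof -
  \<comment> \<open>The bound on \<open>v\<close> that \<open>deviance_ge_half\<close> yields from
    \<open>n * deviance v \<le> a\<close>.\<close>
  define M where "M = 2 * (a / n + 1)"
  define K where "K = {v\<in>{T..M}. n * deviance v \<le> a}"
  \<comment> \<open>The closed interval contains \<open>T\<close>, which \<open>far\<close> makes
    inadmissible; hence the compact \<open>K\<close> is the whole admissible set.\<close>
  have K_iff: "v \<in> K \<longleftrightarrow> T < v \<and> n * deviance v \<le> a" for v
  proof
    assume v: "T < v \<and> n * deviance v \<le> a"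
    then have "deviance v \<le> a / n"
      using pos by (simp add: pos_le_divide_eq mult.commute)
    then have "v / 2 - 1 \<le> a / n"
      using deviance_ge_half[of v] T v by linarith
    with v show "v \<in> K" by (auto simp: K_def M_def)
  next
    assume "v \<in> K"
    then show "T < v \<and> n * deviance v \<le> a" using far by (cases "v = T") (auto simp: K_def)
  qed
  have "continuous_on {T..M} (\<lambda>v. n * deviance v)"
    unfolding deviance_def using T by (intro continuous_intros) auto
  then have "closed {v\<in>{T..M}. n * deviance v \<le> a}"
    by (intro continuous_on_closed_Collect_le continuous_on_const) auto
  then have "compact K"
    unfolding K_def compact_eq_bounded_closed
    by (auto intro: bounded_subset[OF bounded_closed_interval])
  moreover have "1 \<in> K" using T pos by (auto simp: K_iff)
  moreover have "continuous_on K (penalized_es k n b T)"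
    unfolding penalized_es_def pareto_es_def deviance_def
    using T b pos by (intro continuous_intros) (auto simp: K_iff)
  ultimately obtain w where w: "w \<in> K" and
      wmax: "\<And>v. v \<in> K \<Longrightarrow> penalized_es k n b T v \<le> penalized_es k n b T w"
    using continuous_attains_sup[of K "penalized_es k n b T"] by blast
  have "\<exists>u>T. n * deviance u < a \<and> penalized_es k n b T w \<le> penalized_es k n b T u"
  \<comment> \<open>A maximizer at or above 1 can be replaced by 1, where the deviance is 0. One
    below 1 on the boundary is left to the hypothesis \<open>boundary\<close>.\<close>
  proof (cases "n * deviance w < a \<or> 1 \<le> w")
    case True
    then show ?thesis
      using w T pos penalized_es_le_1[OF b pos(1,2) T, of w]
      by (auto simp: K_iff intro: exI[of _ w] exI[of _ 1])
  next
    case False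
    then show ?thesis using boundary[of w] w by (auto simp: K_iff)
  qed
  then obtain u where "T < u" "n * deviance u < a" "penalized_es k n b T w \<le> penalized_es k n b T u"
    by blast
  then show ?thesis
    unfolding interior_max_set_def using T wmax by (force simp: K_iff)
qed

text \<open>Otherwise every \<open>u\<close> between \<open>T\<close> and 1 is admissible at a
  penalty of at most \<open>a / k\<close>, while the shortfall is unbounded as \<open>u\<close>
  approaches \<open>T\<close>, so no maximum exists.\<close>

lemma interior_max_set_far:
  assumes b: "0 < b" "b < 1" and pos: "0 < k" "0 < n" and T: "T \<in> interior_max_set k n a b"
  shows "a < n * deviance T"
proof (rule ccontr)
  assume near: "\<not> a < n * deviance T"
  obtain u where T1: "0 < T" "T < 1" and
    u: "\<And>v. T < v \<Longrightarrow> n * deviance v \<le> a \<Longrightarrow> penalized_es k n b T v \<le> penalized_es k n b T u"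
    using T by (auto simp: interior_max_set_def)
  obtain p where p: "T < p" "p < 1" "penalized_es k n b T u + a / k < pareto_es b p"
    using pareto_es_unbounded[OF b T1(2)] by blast
  have v: "T < T / p" "T / p < 1" using p T1 by (auto simp: field_simps)
  have "n * deviance (T / p) \<le> n * deviance T"
    using deviance_strict_antimono[OF T1(1) v(1)] v pos by simp
  then have adm: "n * deviance (T / p) \<le> a" using near by simp
  have "pareto_es b p - a / k \<le> penalized_es k n b T (T / p)"
    using adm T1 p pos by (simp add: penalized_es_def divide_right_mono)
  also have "\<dots> \<le> penalized_es k n b T u" using u v adm by simp
  finally show False using p by simp
qed

text \<open>Neither the admissible set nor the penalty changes when \<open>T'\<close> is lowered to
  \<open>T\<close>, while the lead in shortfall of the lower end shrinks. Hence the maximizer for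
  \<open>T'\<close> still beats the lower end for \<open>T\<close>.\<close>

lemma interior_max_set_downward:
  assumes b: "0 < b" "b < 1" and pos: "0 < k" "0 < n" "0 < a"
    and T': "T' \<in> interior_max_set k n a b" and T: "0 < T" "T \<le> T'"
  shows "T \<in> interior_max_set k n a b"
proof (cases "T = T'")
  case False
  note far = interior_max_set_far[OF b pos(1,2) T']
  obtain u where T1: "0 < T'" "T' < 1" and u: "T' < u" "n * deviance u < a" and
    max: "\<And>v. T' < v \<Longrightarrow> n * deviance v \<le> a \<Longrightarrow>
      penalized_es k n b T' v \<le> penalized_es k n b T' u"
    using T' by (auto simp: interior_max_set_def)
  have outside: "a < n * deviance v" if "0 < v" "v \<le> T'" for v
    using deviance_strict_antimono[of v T'] far that T1 pos
    by (cases "v = T'") (auto intro: less_trans)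
  show ?thesis
  proof (rule interior_max_setI[OF b pos T(1)])
    show "T < 1" "a < n * deviance T" using outside T T1 by auto
    fix w assume w: "T < w" "w < 1" "n * deviance w = a"
    have "T' < w" using outside[of w] w T by force
    \<comment> \<open>As \<open>w < 1\<close> has the larger deviance, \<open>u\<close> lies to its
      right: \<open>w\<close> is the lower end.\<close>
    have "deviance u < deviance w" using u w pos by (metis mult_less_cancel_left_pos)
    then have "w < u"
      using deviance_strict_antimono[of u w] w u T1 by (metis linorder_neqE_linordered_idom less_imp_le less_irrefl less_trans)
    have le: "pareto_es b (1 * (T / w)) - pareto_es b (1 * (T / u))
        \<le> pareto_es b (T' / T * (T / w)) - pareto_es b (T' / T * (T / u))"
      using b T T1 \<open>w < u\<close> \<open>T' < w\<close> by (intro pareto_es_diff_scale_mono) (auto simp: divide_simps)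
    have eqs: "T' / T * (T / w) = T' / w" "T' / T * (T / u) = T' / u" using T by auto
    have "penalized_es k n b T' w \<le> penalized_es k n b T' u"
      using max \<open>T' < w\<close> w by simp
    then have "penalized_es k n b T w \<le> penalized_es k n b T u"
      using le[unfolded eqs mult_1] by (simp add: penalized_es_def)
    then show "\<exists>u>T. n * deviance u < a \<and> penalized_es k n b T w \<le> penalized_es k n b T u"
      using u T by (intro exI[of _ u]) auto
  qed
qed (use T' in simp)

lemma interior_max_set_borel:
  assumes "0 < b" "b < 1" "0 < k" "0 < n" "0 < a"
  shows "interior_max_set k n a b \<in> sets borel"
proof (rule real_interval_borel_measurable)
  show "is_interval (interior_max_set k n a b)"
    unfolding is_interval_1
  proof (intro ballI allI impI)
    fix S T x
    assume "S \<in> interior_max_set k n a b" "T \<in> interior_max_set k n a b" "S \<le> x \<and> x \<le> T"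
    then show "x \<in> interior_max_set k n a b"
      using interior_max_set_downward[OF assms, of T x] by (force simp: interior_max_set_def)
  qed
qed

text \<open>A boundary point \<open>w < 1\<close> exceeds \<open>t / q\<close>, so the shortfall
  there is at most \<open>pareto_es b q\<close>, which the penalty \<open>a / k\<close> absorbs. The
  objective at \<open>w\<close> is then at most 0, while \<open>u = 1\<close> has no penalty and
  gives at least 0.\<close>

lemma interior_max_set_explicit:
  assumes b: "0 < b" "b < 1" and pos: "0 < k" "0 < n" "0 < a"
    and t: "0 < t" "t < q" "q < 1" and far: "a < n * deviance (t / q)"
    and small: "pareto_es b q \<le> a / k"
  shows "t \<in> interior_max_set k n a b"
proof (rule interior_max_setI[OF b pos t(1)])
  have tq: "t < t / q" "t / q < 1" using t by (auto simp: field_simps)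
  have "deviance (t / q) < deviance t" using deviance_strict_antimono[OF t(1) tq(1)] tq by simp
  then show "a < n * deviance t" using far pos by (meson less_trans mult_strict_left_mono)
  show "t < 1" using t by simp
  fix w assume w: "t < w" "w < 1" "n * deviance w = a"
  have "t / q < w"
  proof (rule ccontr)
    assume "\<not> t / q < w"
    then have "deviance (t / q) \<le> deviance w"
      using deviance_strict_antimono[of w "t / q"] w tq t by (cases "w = t / q") auto
    with far w pos show False by (smt (verit) mult_left_mono)
  qed
  then have "t / w \<le> q" using t w by (simp add: field_simps)
  then have "pareto_es b (t / w) \<le> pareto_es b q" using b t by (intro pareto_es_mono) auto
  then have "penalized_es k n b t w \<le> 0" using w small by (simp add: penalized_es_def)
  also have "0 \<le> penalized_es k n b t 1"
    using t by (simp add: penalized_es_def pareto_es_nonneg)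
  finally show "\<exists>u>t. n * deviance u < a \<and> penalized_es k n b t w \<le> penalized_es k n b t u"
    using t pos by (intro exI[of _ 1]) auto
qed

section \<open>Pareto likelihood and regularity as a condition on \<open>T\<close>\<close>

lemma elog_pareto_density:
  assumes "0 < \<theta>"
  shows "elog (pareto_density x \<theta>) = (if 1 < x then ereal (ln \<theta> - (1 + \<theta>) * ln x) else - \<infinity>)"
  using assms by (simp add: elog_def pareto_density_def ln_mult ln_powr algebra_simps)

lemma loglik_pareto:
  assumes "0 < \<theta>" "0 < N" "\<And>i. i \<in> {1..N} \<Longrightarrow> 1 < x i"
  shows "loglik pareto_density N x \<theta> =
    ereal (real N * (ln \<theta> - (1 + \<theta>) * ((\<Sum>i=1..N. ln (x i)) / real N)))"
proof -
  have "loglik pareto_density N x \<theta> = (\<Sum>i=1..N. ereal (ln \<theta> - (1 + \<theta>) * ln (x i)))"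
    unfolding loglik_def using assms by (intro sum.cong) (auto simp: elog_pareto_density)
  also have "\<dots> = ereal (\<Sum>i=1..N. ln \<theta> - (1 + \<theta>) * ln (x i))" by simp
  also have "(\<Sum>i=1..N. ln \<theta> - (1 + \<theta>) * ln (x i)) = real N * ln \<theta> - (1 + \<theta>) * (\<Sum>i=1..N. ln (x i))"
    by (simp add: sum_subtractf sum_distrib_left)
  finally show ?thesis using assms by (simp add: right_diff_distrib)
qed

lemma loglik_pareto_outside:
  assumes "0 < \<theta>" "i \<in> {1..N}" "x i \<le> 1"
  shows "loglik pareto_density N x \<theta> = - \<infinity>"
proof -
  have "loglik pareto_density N x \<theta> =
      elog (pareto_density (x i) \<theta>) + (\<Sum>j\<in>{1..N} - {i}. elog (pareto_density (x j) \<theta>))"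
    unfolding loglik_def using assms by (intro sum.remove) auto
  \<comment> \<open>In \<open>ereal\<close> a summand \<open>\<infinity>\<close> would win over
    \<open>- \<infinity>\<close>, so it has to be excluded among the other terms.\<close>
  moreover have "(\<Sum>j\<in>{1..N} - {i}. elog (pareto_density (x j) \<theta>)) \<noteq> \<infinity>"
    unfolding sum_Pinfty using assms by (auto simp: elog_pareto_density)
  ultimately show ?thesis
    using assms by (simp add: elog_pareto_density)
qed

lemma not_regular_outside:
  assumes "i \<in> {1..N}" "x i \<le> 1"
  shows "\<not> regular {1<..} pareto_density k \<gamma> \<delta> r N x"
proof -
  have "loglik pareto_density N x \<theta> = - \<infinity>" if "\<theta> \<in> {1<..}" for \<theta>
    using loglik_pareto_outside[of \<theta> i N x] that assms by simp
  then show ?thesis by (auto simp: regular_def divergence_def)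
qed

text \<open>With real likelihoods and risks, regularity concerns the maximum of a real function;
  attainment already makes the supremum finite.\<close>

lemma regular_iff_attained:
  assumes L: "\<And>\<theta>. \<theta> \<in> \<Theta> \<Longrightarrow> loglik f N x \<theta> = ereal (L \<theta>)"
    and s: "(SUP \<theta>\<in>\<Theta>. loglik f N x \<theta>) = ereal s"
    and r: "\<And>\<theta>. \<theta> \<in> \<Theta> \<Longrightarrow> r \<theta> = ereal (\<rho> \<theta>)"
    and k: "0 < k"
  shows "regular \<Theta> f k 1 \<delta> r N x \<longleftrightarrow>
    (\<exists>\<theta>\<in>\<Theta>. s - L \<theta> < real N powr \<delta> \<and>
      (\<forall>\<theta>'\<in>\<Theta>. s - L \<theta>' \<le> real N powr \<delta> \<longrightarrow> \<rho> \<theta>' - (s - L \<theta>') / k \<le> \<rho> \<theta> - (s - L \<theta>) / k))"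
    (is "_ \<longleftrightarrow> (\<exists>\<theta>\<in>\<Theta>. ?adm \<theta> \<and> ?max \<theta>)")
proof -
  have div: "divergence \<Theta> f N x \<theta> = ereal (s - L \<theta>)" if "\<theta> \<in> \<Theta>" for \<theta>
    using that unfolding divergence_def s by (simp add: L)
  \<comment> \<open>Nonnegativity of the divergence makes the power with exponent 1 the
    identity.\<close>
  have le_s: "L \<theta> \<le> s" if "\<theta> \<in> \<Theta>" for \<theta>
    using SUP_upper[OF that, of "loglik f N x"] that unfolding s by (simp add: L)
  have obj: "DR_objective \<Theta> f k 1 \<delta> r N x \<theta> = ereal (\<rho> \<theta> - (s - L \<theta>) / k)"
    if "\<theta> \<in> \<Theta>" "s - L \<theta> \<le> real N powr \<delta>" for \<theta>
    using that le_s[OF that(1)] k by (simp add: DR_objective_def trunc_divergence_def div r)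
  define A where "A = {\<theta>\<in>\<Theta>. s - L \<theta> \<le> real N powr \<delta>}"
  have A: "{\<theta>\<in>\<Theta>. trunc_divergence \<Theta> f \<delta> N x \<theta> < \<infinity>} = A"
    by (auto simp: A_def trunc_divergence_def div)
  have E: "DR_expectation \<Theta> f k 1 \<delta> r N x = (SUP \<theta>\<in>A. ereal (\<rho> \<theta> - (s - L \<theta>) / k))"
    unfolding DR_expectation_def A by (intro SUP_cong) (auto simp: A_def obj)
  show ?thesis
  proof
    assume "regular \<Theta> f k 1 \<delta> r N x"
    then obtain \<theta> where \<theta>: "\<theta> \<in> \<Theta>" "divergence \<Theta> f N x \<theta> < ereal (real N powr \<delta>)"
      "DR_objective \<Theta> f k 1 \<delta> r N x \<theta> = DR_expectation \<Theta> f k 1 \<delta> r N x"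
      by (auto simp: regular_def)
    have "?adm \<theta>" using \<theta> by (simp add: div)
    then have "ereal (\<rho> \<theta> - (s - L \<theta>) / k) = (SUP \<theta>\<in>A. ereal (\<rho> \<theta> - (s - L \<theta>) / k))"
      using \<theta> obj E by simp
    then have "ereal (\<rho> \<theta>' - (s - L \<theta>') / k) \<le> ereal (\<rho> \<theta> - (s - L \<theta>) / k)" if "\<theta>' \<in> A" for \<theta>'
      using that by (metis (no_types, lifting) SUP_upper)
    then have "?max \<theta>" by (auto simp: A_def)
    with \<theta> \<open>?adm \<theta>\<close> show "\<exists>\<theta>\<in>\<Theta>. ?adm \<theta> \<and> ?max \<theta>" by blast
  next
    assume "\<exists>\<theta>\<in>\<Theta>. ?adm \<theta> \<and> ?max \<theta>"
    then obtain \<theta> where \<theta>: "\<theta> \<in> \<Theta>" "?adm \<theta>" "?max \<theta>" by blast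
    have "(SUP \<theta>\<in>A. ereal (\<rho> \<theta> - (s - L \<theta>) / k)) = ereal (\<rho> \<theta> - (s - L \<theta>) / k)"
      using \<theta> by (intro SUP_eqI) (auto simp: A_def)
    then show "regular \<Theta> f k 1 \<delta> r N x"
      unfolding regular_def using \<theta> E obj by (auto simp: div intro!: bexI[of _ \<theta>])
  qed
qed

text \<open>For \<open>T < 1\<close> this is the substitution \<open>u = \<theta> * T\<close>. For
  \<open>T \<ge> 1\<close> both sides fail: the likelihood decreases in \<open>\<theta>\<close>, so
  parameters near 1 are admissible, and their shortfall is unbounded.\<close>

lemma regular_pareto_iff:
  assumes b: "0 < b" "b < 1" and k: "0 < k" and N: "0 < N"
    and x: "\<And>i. i \<in> {1..N} \<Longrightarrow> 1 < x i"
    and r: "\<And>\<theta>. 1 < \<theta> \<Longrightarrow> r \<theta> = ereal (pareto_es b (1 / \<theta>))"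
  shows "regular {1<..} pareto_density k 1 \<delta> r N x \<longleftrightarrow>
    (\<Sum>i=1..N. ln (x i)) / real N \<in> interior_max_set k (real N) (real N powr \<delta>) b"
proof -
  define T where "T = (\<Sum>i=1..N. ln (x i)) / real N"
  have "0 < (\<Sum>i=1..N. ln (x i))" using x N by (intro sum_pos ln_gt_zero) auto
  then have T: "0 < T" using N by (simp add: T_def)
  define L where "L \<theta> = real N * (ln \<theta> - (1 + \<theta>) * T)" for \<theta>
  have L: "loglik pareto_density N x \<theta> = ereal (L \<theta>)" if "\<theta> \<in> {1<..}" for \<theta>
    using loglik_pareto[of \<theta> N x] that N x by (simp add: L_def T_def)
  show ?thesis
  proof (cases "T < 1")
    case True
    have diff: "L (1 / T) - L \<theta> = real N * deviance (\<theta> * T)" if "0 < \<theta>" for \<theta>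
      using that T by (simp add: L_def deviance_def ln_mult ln_div field_simps)
    have s: "(SUP \<theta>\<in>{1<..}. loglik pareto_density N x \<theta>) = ereal (L (1 / T))"
    proof (rule SUP_eqI)
      fix \<theta> :: real assume \<theta>: "\<theta> \<in> {1<..}"
      then have "0 \<le> L (1 / T) - L \<theta>"
        using diff[of \<theta>] deviance_nonneg[of "\<theta> * T"] T by simp
      then show "loglik pareto_density N x \<theta> \<le> ereal (L (1 / T))" using L[OF \<theta>] by simp
    next
      fix y assume y: "\<And>\<theta>. \<theta> \<in> {1<..} \<Longrightarrow> loglik pareto_density N x \<theta> \<le> y"
      have "1 / T \<in> {1<..}" using T True by simp
      then show "ereal (L (1 / T)) \<le> y" using y[of "1 / T"] L by simp
    qed
    let ?P = "\<lambda>u. real N * deviance u < real N powr \<delta>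
      \<and> (\<forall>v>T. real N * deviance v \<le> real N powr \<delta> \<longrightarrow>
            penalized_es k (real N) b T v \<le> penalized_es k (real N) b T u)"
    have scale: "(\<exists>u>T. Q u) \<longleftrightarrow> (\<exists>\<theta>\<in>{1<..}. Q (\<theta> * T))"
      "(\<forall>u>T. Q u) \<longleftrightarrow> (\<forall>\<theta>\<in>{1<..}. Q (\<theta> * T))" for Q
    proof -
      have "{T<..} = (\<lambda>\<theta>. \<theta> * T) ` {1<..}"
        using T by (auto simp: image_def field_simps intro!: bexI[of _ "_ / T"])
      then have eq: "{T<..} = (\<lambda>\<theta>. \<theta> * T) ` {1<..}" .
      have *: "(\<exists>u\<in>{T<..}. Q u) \<longleftrightarrow> (\<exists>\<theta>\<in>{1<..}. Q (\<theta> * T))"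
        "(\<forall>u\<in>{T<..}. Q u) \<longleftrightarrow> (\<forall>\<theta>\<in>{1<..}. Q (\<theta> * T))"
        unfolding eq by blast+
      show "(\<exists>u>T. Q u) \<longleftrightarrow> (\<exists>\<theta>\<in>{1<..}. Q (\<theta> * T))"
        "(\<forall>u>T. Q u) \<longleftrightarrow> (\<forall>\<theta>\<in>{1<..}. Q (\<theta> * T))" using * by auto
    qed
    have pen: "penalized_es k (real N) b T (\<theta> * T) = pareto_es b (1 / \<theta>) - (L (1 / T) - L \<theta>) / k"
      if "\<theta> \<in> {1<..}" for \<theta>
      using that diff[of \<theta>] T by (simp add: penalized_es_def)
    have "T \<in> interior_max_set k (real N) (real N powr \<delta>) b \<longleftrightarrow> (\<exists>u>T. ?P u)"
      using T True by (simp add: interior_max_set_def)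
    also have "\<dots> \<longleftrightarrow> regular {1<..} pareto_density k 1 \<delta> r N x"
      unfolding scale using diff
      by (subst regular_iff_attained[OF L s _ k, where \<rho> = "\<lambda>\<theta>. pareto_es b (1 / \<theta>)"])
         (auto simp: r pen)
    finally show ?thesis by (simp add: T_def)
  next
    case False
    \<comment> \<open>\<open>- 2 * real N * T\<close> is the value of \<open>L\<close> at the
      excluded parameter 1, which bounds all the others.\<close>
    have bound: "- 2 * real N * T - L \<theta> \<le> real N * (T * (\<theta> - 1))" if "1 < \<theta>" for \<theta>
    proof -
      have "0 \<le> real N * ln \<theta>" using that by simp
      then show ?thesis by (simp add: L_def algebra_simps)
    qed
    have L_le: "L \<theta> \<le> - 2 * real N * T" if "1 < \<theta>" for \<theta>
    proof -
      have "ln \<theta> \<le> \<theta> - 1" using that by (intro ln_le_minus_one) auto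
      also have "\<dots> \<le> (\<theta> - 1) * T" using that False by simp
      finally have "real N * ln \<theta> \<le> real N * ((\<theta> - 1) * T)" by (intro mult_left_mono) auto
      then show ?thesis by (simp add: L_def algebra_simps)
    qed
    define s where "s = real_of_ereal (SUP \<theta>\<in>{1<..}. loglik pareto_density N x \<theta>)"
    have "(SUP \<theta>\<in>{1<..}. loglik pareto_density N x \<theta>) \<le> ereal (- 2 * real N * T)"
      using L L_le by (intro SUP_least) auto
    moreover have "ereal (L 2) \<le> (SUP \<theta>\<in>{1<..}. loglik pareto_density N x \<theta>)"
      using L[of 2] by (intro SUP_upper2[of 2]) auto
    ultimately have s: "(SUP \<theta>\<in>{1<..}. loglik pareto_density N x \<theta>) = ereal s"
      and s_le: "s \<le> - 2 * real N * T"
      unfolding s_def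
      by (cases "SUP \<theta>\<in>{1<..}. loglik pareto_density N x \<theta>"; simp)+
    have "\<not> regular {1<..} pareto_density k 1 \<delta> r N x"
    proof
      assume reg: "regular {1<..} pareto_density k 1 \<delta> r N x"
      obtain B where B: "\<And>\<theta>. 1 < \<theta> \<Longrightarrow> s - L \<theta> \<le> real N powr \<delta> \<Longrightarrow>
          pareto_es b (1 / \<theta>) - (s - L \<theta>) / k \<le> B"
        using regular_iff_attained[OF L s _ k, of r "\<lambda>\<theta>. pareto_es b (1 / \<theta>)" \<delta>] r reg that
        by (metis greaterThan_iff)
      \<comment> \<open>Every \<open>\<theta>\<close> in \<open>(1, 1 + e]\<close> has divergence at
        most the truncation level, and \<open>p > 1 / (1 + e)\<close> puts \<open>1 / p\<close> in
        that range.\<close>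
      define e where "e = real N powr \<delta> / (real N * T)"
      have e: "0 < e" "real N * (T * e) = real N powr \<delta>" using N T by (auto simp: e_def)
      obtain p where p: "1 / (1 + e) < p" "p < 1" "0 < p" "B + real N powr \<delta> / k < pareto_es b p"
        using pareto_es_unbounded[OF b, of "1 / (1 + e)"] e by auto
      have \<theta>: "1 < 1 / p" "1 / p - 1 \<le> e" using p e by (auto simp: field_simps)
      have "s - L (1 / p) \<le> real N * (T * (1 / p - 1))" using bound[OF \<theta>(1)] s_le by simp
      also have "\<dots> \<le> real N * (T * e)" using \<theta> T by (intro mult_left_mono) auto
      finally have adm: "s - L (1 / p) \<le> real N powr \<delta>" using e by simp
      then have "(s - L (1 / p)) / k \<le> real N powr \<delta> / k" using k by (intro divide_right_mono) auto
      then show False using B[OF \<theta>(1) adm] p by simp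
    qed
    moreover have "T \<notin> interior_max_set k (real N) (real N powr \<delta>) b"
      using False by (simp add: interior_max_set_def)
    ultimately show ?thesis by (simp add: T_def)
  qed
qed

section \<open>Tail, quantile and expected shortfall of the Pareto law\<close>

lemma pareto_density_measurable [measurable]: "(\<lambda>x. pareto_density x \<theta>) \<in> borel_measurable borel"
  unfolding pareto_density_def by measurable

lemma nn_integral_powr_tail:
  fixes q s c :: real
  assumes "0 < q" "0 < s" "0 \<le> c"
  shows "(\<integral>\<^sup>+x. ennreal (c * x powr (- (1 + s))) * indicator {q..} x \<partial>lborel) =
    ennreal (c / s * q powr (- s))"
proof -
  have "((\<lambda>x. - c / s * x powr (- s)) \<longlongrightarrow> - c / s * 0) at_top"
    using assms by (intro tendsto_intros tendsto_neg_powr filterlim_ident) auto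
  then have "(\<integral>\<^sup>+x. ennreal (c * x powr (- (1 + s))) * indicator {q..} x \<partial>lborel) =
      ennreal (- c / s * 0 - (- c / s * q powr (- s)))"
    using assms
    by (intro nn_integral_FTC_atLeast)
       (auto intro!: derivative_eq_intros simp: powr_diff powr_minus powr_add field_simps)
  then show ?thesis by simp
qed

text \<open>The density agrees with the power on the tail except possibly at the endpoint, a null
  set; so open and closed tails give the same integral.\<close>

lemma nn_integral_pareto_tail:
  assumes "0 < \<theta>" "1 \<le> q" "A = {q..} \<or> A = {q<..}" and [measurable]: "g \<in> borel_measurable borel"
  shows "(\<integral>\<^sup>+x. g x * indicator A x \<partial>density lborel (\<lambda>x. ennreal (pareto_density x \<theta>))) =
    (\<integral>\<^sup>+x. ennreal (\<theta> * x powr (- (1 + \<theta>))) * g x * indicator {q..} x \<partial>lborel)"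
proof -
  have [measurable]: "A \<in> sets borel" using assms by auto
  have "(\<integral>\<^sup>+x. g x * indicator A x \<partial>density lborel (\<lambda>x. ennreal (pareto_density x \<theta>))) =
      (\<integral>\<^sup>+x. ennreal (pareto_density x \<theta>) * (g x * indicator A x) \<partial>lborel)"
    by (subst nn_integral_density) auto
  also have "\<dots> = (\<integral>\<^sup>+x. ennreal (\<theta> * x powr (- (1 + \<theta>))) * g x * indicator {q..} x \<partial>lborel)"
    using AE_lborel_singleton[of q] assms(2,3)
    by (intro nn_integral_cong_AE)
       (auto elim!: eventually_mono simp: pareto_density_def split: split_indicator)
  finally show ?thesis .
qed

lemma emeasure_pareto_tail:
  assumes "0 < \<theta>" "1 \<le> q" "A = {q..} \<or> A = {q<..}"
  shows "emeasure (density lborel (\<lambda>x. ennreal (pareto_density x \<theta>))) A = ennreal (q powr (- \<theta>))"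
proof -
  have "A \<in> sets borel" using assms by auto
  then have "emeasure (density lborel (\<lambda>x. ennreal (pareto_density x \<theta>))) A =
      (\<integral>\<^sup>+x. 1 * indicator A x \<partial>density lborel (\<lambda>x. ennreal (pareto_density x \<theta>)))"
    by simp
  also have "\<dots> = ennreal (q powr (- \<theta>))"
    using assms nn_integral_powr_tail[of q \<theta> \<theta>]
    by (subst nn_integral_pareto_tail[OF assms]) auto
  finally show ?thesis .
qed

lemma prob_space_pareto:
  assumes "0 < \<theta>"
  shows "prob_space (density lborel (\<lambda>x. ennreal (pareto_density x \<theta>)))"
proof
  let ?M = "density lborel (\<lambda>x. ennreal (pareto_density x \<theta>))"
  have "AE x in ?M. x \<in> {1..}"
    by (subst AE_density) (auto simp: pareto_density_def intro!: AE_I2 split: if_splits)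
  then have "emeasure ?M (space ?M) = emeasure ?M {1..}"
    by (intro emeasure_eq_AE) auto
  then show "emeasure ?M (space ?M) = 1"
    using emeasure_pareto_tail[OF assms, of 1 "{1..}"] by simp
qed

lemma cdf_pareto:
  assumes "0 < \<theta>"
  shows "cdf (density lborel (\<lambda>x. ennreal (pareto_density x \<theta>))) x =
    (if 1 \<le> x then 1 - x powr (- \<theta>) else 0)"
proof -
  define M where "M = density lborel (\<lambda>x. ennreal (pareto_density x \<theta>))"
  interpret prob_space M unfolding M_def by (rule prob_space_pareto[OF assms])
  have [simp]: "sets M = sets borel" "space M = UNIV" by (simp_all add: M_def)
  have tail: "prob {y<..} = y powr (- \<theta>)" if "1 \<le> y" for y
    using emeasure_pareto_tail[OF assms that] unfolding M_def measure_def by simp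
  have "cdf M y = 1 - y powr (- \<theta>)" if "1 \<le> y" for y
    using prob_compl[of "{y<..}"] tail[OF that] by (simp add: cdf_def Compl_eq_Diff_UNIV[symmetric])
  moreover have "cdf M x \<le> cdf M 1" if "x \<le> 1"
    unfolding cdf_def using that by (intro finite_measure_mono) auto
  ultimately show ?thesis
    using measure_nonneg[of M "{..x}"] unfolding M_def[symmetric] by (force simp: cdf_def)
qed

lemma quantile_pareto:
  assumes "0 < \<theta>" "0 < b" "b < 1"
  shows "quantile (density lborel (\<lambda>x. ennreal (pareto_density x \<theta>))) (1 - b) = b powr (- 1 / \<theta>)"
proof -
  have "1 \<le> b powr (- 1 / \<theta>)"
    using assms powr_mono'[of "- 1 / \<theta>" 0 b] by simp
  moreover have "x powr (- \<theta>) \<le> b \<longleftrightarrow> b powr (- 1 / \<theta>) \<le> x" if "1 \<le> x" for x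
  proof -
    have "x powr (- \<theta>) \<le> b \<longleftrightarrow> ln (x powr (- \<theta>)) \<le> ln b" using that assms by (subst ln_le_cancel_iff) auto
    also have "\<dots> \<longleftrightarrow> ln (b powr (- 1 / \<theta>)) \<le> ln x" using assms that by (auto simp add: ln_powr field_simps)
    also have "\<dots> \<longleftrightarrow> b powr (- 1 / \<theta>) \<le> x" using that assms by (subst ln_le_cancel_iff) auto
    finally show ?thesis .
  qed
  ultimately have "{x. 1 - b \<le> (if 1 \<le> x then 1 - x powr (- \<theta>) else 0)} = {b powr (- 1 / \<theta>)..}"
    using assms by (auto split: if_splits)
  then show ?thesis by (simp add: quantile_def cdf_pareto[OF assms(1)])
qed

lemma expected_shortfall_pareto:
  assumes "1 < \<theta>" "0 < b" "b < 1"
  shows "expected_shortfall b (density lborel (\<lambda>x. ennreal (pareto_density x \<theta>))) =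
    ereal (pareto_es b (1 / \<theta>))"
proof -
  define M where "M = density lborel (\<lambda>x. ennreal (pareto_density x \<theta>))"
  define q where "q = b powr (- 1 / \<theta>)"
  define C where "C = uniform_measure M {q..}"
  have quant: "quantile M (1 - b) = q"
    unfolding M_def q_def using quantile_pareto assms by simp
  have q: "1 \<le> q"
    unfolding q_def using assms powr_mono'[of "- 1 / \<theta>" 0 b] by simp
  have "q powr (- \<theta>) = b" using assms by (simp add: q_def powr_powr)
  then have tail: "emeasure M {q..} = ennreal b"
    unfolding M_def using emeasure_pareto_tail[of \<theta> q] assms q by simp
  have "(\<integral>\<^sup>+x. ennreal x * indicator {q..} x \<partial>M) =
      (\<integral>\<^sup>+x. ennreal (\<theta> * x powr (- (1 + \<theta>))) * ennreal x * indicator {q..} x \<partial>lborel)"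
    unfolding M_def using assms q by (intro nn_integral_pareto_tail) auto
  also have "\<dots> = (\<integral>\<^sup>+x. ennreal (\<theta> * x powr (- (1 + (\<theta> - 1)))) * indicator {q..} x \<partial>lborel)"
    using q assms
    by (intro nn_integral_cong)
       (auto split: split_indicator simp: ennreal_mult[symmetric] powr_diff powr_minus field_simps)
  also have "\<dots> = ennreal (\<theta> / (\<theta> - 1) * q powr (- (\<theta> - 1)))"
    using q assms by (intro nn_integral_powr_tail) auto
  also have "q powr (- (\<theta> - 1)) = b * q"
    using \<open>q powr (- \<theta>) = b\<close> q by (simp add: powr_diff powr_minus field_simps)
  finally have mean: "(\<integral>\<^sup>+x. ennreal x \<partial>C) = ennreal (\<theta> / (\<theta> - 1) * (b * q)) / ennreal b"
    unfolding C_def tail[symmetric] by (subst nn_integral_uniform_measure) (auto simp: M_def)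
  also have "\<dots> = ennreal (\<theta> / (\<theta> - 1) * q)"
    using assms q by (subst divide_ennreal) auto
  also have "\<theta> / (\<theta> - 1) * q = pareto_es b (1 / \<theta>)"
    using assms by (simp add: pareto_es_def q_def field_simps)
  finally have mean': "(\<integral>\<^sup>+x. ennreal x \<partial>C) = ennreal (pareto_es b (1 / \<theta>))" .
  \<comment> \<open>Nonnegativity turns the integral in \<open>ennreal\<close> into a Bochner
    integral, which selects the finite branch of \<open>expected_shortfall\<close>.\<close>
  have "AE x in C. 0 \<le> x"
    unfolding C_def using q by (intro AE_uniform_measureI) (auto simp: M_def)
  then have "has_bochner_integral C (\<lambda>x. x) (pareto_es b (1 / \<theta>))"
    using mean' assms
    by (intro has_bochner_integral_nn_integral) (auto simp: C_def M_def pareto_es_nonneg)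
  then show ?thesis
    unfolding expected_shortfall_def M_def[symmetric] quant C_def[symmetric] Let_def
    by (auto simp: has_bochner_integral_iff)
qed

section \<open>Concentration of the mean of the logarithms\<close>

text \<open>The Pareto distribution function at \<open>exp a\<close> is the exponential one at
  \<open>a\<close>. Sums of independent logarithms are then Erlang distributed, with known
  moments.\<close>

lemma (in prob_space) pareto_imp_ln_exponential:
  assumes "0 < \<theta>" and X: "distributed M lborel X (\<lambda>x. ennreal (pareto_density x \<theta>))"
  shows "distributed M lborel (\<lambda>\<omega>. ln (X \<omega>)) (exponential_density \<theta>)" "AE \<omega> in M. 1 < X \<omega>"
proof -
  have [measurable]: "X \<in> borel_measurable M" using distributed_measurable[OF X] by simp
  show gt1: "AE \<omega> in M. 1 < X \<omega>"
    by (subst distributed_AE2[OF X]) (auto simp: pareto_density_def intro!: AE_I2 split: if_splits)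
  show "distributed M lborel (\<lambda>\<omega>. ln (X \<omega>)) (exponential_density \<theta>)"
    unfolding exponential_distributed_iff[OF assms(1)]
  proof (intro conjI allI impI)
    fix a :: real assume "0 \<le> a"
    have "\<P>(\<omega> in M. ln (X \<omega>) \<le> a) = \<P>(\<omega> in M. X \<omega> \<le> exp a)"
      using gt1 by (intro prob_eq_AE) (auto elim!: eventually_mono simp: ln_le_cancel_iff[of _ "exp a", simplified, symmetric])
    also have "\<dots> = cdf (distr M lborel X) (exp a)"
      by (simp add: cdf_def measure_distr vimage_def Int_def conj_commute)
    also have "\<dots> = 1 - exp a powr (- \<theta>)"
      using \<open>0 \<le> a\<close> by (simp add: distributed_distr_eq_density[OF X] cdf_pareto[OF assms(1)])
    finally show "\<P>(\<omega> in M. ln (X \<omega>) \<le> a) = 1 - exp (- a * \<theta>)"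
      by (simp add: powr_def mult.commute)
  qed measurable
qed

text \<open>Chebyshev's inequality for the Erlang sum. A one-sided bound suffices later, since
  \<open>interior_max_set\<close> is closed downward among positive numbers.\<close>

lemma (in prob_space) exponential_mean_upper_tail:
  assumes l: "0 < l" and N: "0 < N" and e: "0 < e"
    and Y: "\<And>i. i \<in> {1..N} \<Longrightarrow> distributed M lborel (Y i) (exponential_density l)"
    and ind: "indep_vars (\<lambda>_. borel) Y {1..N}"
  shows "1 - 1 / (l\<^sup>2 * e\<^sup>2 * real N) \<le> prob {\<omega> \<in> space M. (\<Sum>i=1..N. Y i \<omega>) / real N \<le> 1 / l + e}"
proof -
  define S where "S \<omega> = (\<Sum>i=1..N. Y i \<omega>)" for \<omega>
  \<comment> \<open>The Erlang index \<open>N - 1\<close> belongs to \<open>N\<close>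
    summands.\<close>
  have S: "distributed M lborel S (erlang_density (N - 1) l)"
    unfolding S_def using exponential_distributed_sum[OF _ _ l Y ind] N by simp
  have [measurable]: "S \<in> borel_measurable M" using distributed_measurable[OF S] by simp
  have "expectation S = real N / l"
    using erlang_ith_moment[OF l S, of 1] N by (simp add: fact_reduce)
  moreover have "variance S = real N / l\<^sup>2"
    using erlang_distributed_variance[OF l S] N by (simp add: of_nat_diff)
  ultimately have "prob {\<omega> \<in> space M. real N * e \<le> \<bar>S \<omega> - real N / l\<bar>} \<le> real N / l\<^sup>2 / (real N * e)\<^sup>2"
    using Chebyshev_inequality[of S "real N * e"] erlang_ith_moment_integrable[OF l S, of 2] N e by simp
  also have "\<dots> = 1 / (l\<^sup>2 * e\<^sup>2 * real N)"
    using N by (simp add: power2_eq_square)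
  finally have "1 - 1 / (l\<^sup>2 * e\<^sup>2 * real N)
      \<le> prob (space M - {\<omega> \<in> space M. real N * e \<le> \<bar>S \<omega> - real N / l\<bar>})"
    by (subst prob_compl) auto
  also have "\<dots> \<le> prob {\<omega> \<in> space M. S \<omega> / real N \<le> 1 / l + e}"
    using N l by (intro finite_measure_mono) (auto simp: field_simps)
  finally show ?thesis by (simp add: S_def)
qed

section \<open>Asymptotics in \<open>N\<close> and conclusion\<close>

text \<open>With a fixed \<open>q\<close> in \<open>(t, 1)\<close>, the criterion
  \<open>interior_max_set_explicit\<close> asks that \<open>real N powr \<delta>\<close> be small
  against \<open>N\<close> and large against \<open>1 / \<beta> N\<close>. The two bounds on
  \<open>\<delta>\<close> give exactly this.\<close>

lemma eventually_mem_interior_max_set: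
  fixes \<beta> :: "nat \<Rightarrow> real"
  assumes k: "0 < k" and \<beta>: "\<And>N. N \<ge> 1 \<Longrightarrow> 0 < \<beta> N \<and> \<beta> N < 1"
    and o: "(\<lambda>N. inverse (\<beta> N)) \<in> o(\<lambda>N. real N powr (1 - \<eta>))"
    and \<delta>: "1 - \<eta> < \<delta>" "\<delta> < 1" and t: "0 < t" "t < 1"
  shows "\<forall>\<^sub>F N in sequentially. t \<in> interior_max_set k (real N) (real N powr \<delta>) (\<beta> N)"
proof -
  obtain q where q: "t < q" "q < 1" using dense[OF t(2)] by blast
  have "0 < deviance (t / q)"
    using deviance_strict_antimono[of "t / q" 1] q t by simp
  have large: "\<forall>\<^sub>F N in sequentially. B < real N powr c" if "0 < c" for B c :: real
  proof -
    have "\<forall>\<^sub>F N in sequentially. \<bar>B\<bar> powr (1 / c) < real N"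
      using filterlim_real_sequentially unfolding filterlim_at_top_dense by blast
    then show ?thesis
    proof eventually_elim
      case (elim N)
      have "\<bar>B\<bar> = (\<bar>B\<bar> powr (1 / c)) powr c" using that by (simp add: powr_powr)
      also have "\<dots> < real N powr c" using elim that by (intro powr_less_mono2) auto
      finally show ?case by simp
    qed
  qed
  have inv: "\<forall>\<^sub>F N in sequentially. inverse (\<beta> N) \<le> real N powr (1 - \<eta>)"
    using landau_o.smallD[OF o zero_less_one] eventually_ge_at_top[of 1]
  proof eventually_elim
    case (elim N)
    then show ?case using \<beta>[of N] by simp
  qed
  have "0 < 1 - \<delta>" "0 < \<delta> - (1 - \<eta>)" using \<delta> by auto
  from large[OF this(1), of "1 / deviance (t / q)"] large[OF this(2), of "k / (1 - q)"]
    inv eventually_ge_at_top[of 1]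
  show ?thesis
  proof eventually_elim
    case (elim N)
    then have N: "0 < real N" and b: "0 < \<beta> N" "\<beta> N < 1" using \<beta>[of N] by auto
    show ?case
    proof (rule interior_max_set_explicit[OF b k N _ t(1) q])
      have "1 < real N powr (1 - \<delta>) * deviance (t / q)"
        using elim(1) \<open>0 < deviance (t / q)\<close> \<delta> by (simp add: field_simps)
      then have "real N powr \<delta> * 1 < real N powr \<delta> * (real N powr (1 - \<delta>) * deviance (t / q))"
        using N by (intro mult_strict_left_mono) auto
      also have "\<dots> = real N * deviance (t / q)"
        using N by (simp add: mult.assoc[symmetric] powr_add[symmetric])
      finally show "real N powr \<delta> < real N * deviance (t / q)" by simp
      have "\<beta> N powr (- q) \<le> \<beta> N powr (- 1)" using b q by (intro powr_mono') auto
      also have "\<dots> \<le> real N powr (1 - \<eta>)" using elim(3) b by (simp add: powr_minus)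
      finally have "pareto_es (\<beta> N) q \<le> real N powr (1 - \<eta>) / (1 - q)"
        using q by (simp add: pareto_es_def divide_right_mono)
      also have "\<dots> \<le> real N powr (1 - \<eta>) * (real N powr (\<delta> - (1 - \<eta>)) / k)"
        using elim(2) q k \<delta> by (subst divide_inverse) (intro mult_left_mono, auto simp: field_simps)
      also have "\<dots> = real N powr \<delta> / k"
        using N by (simp add: powr_add[symmetric])
      finally show "pareto_es (\<beta> N) q \<le> real N powr \<delta> / k" .
    qed (use N in simp)
  qed
qed

theorem theorem2:
  fixes Q :: "real \<Rightarrow> 'w measure" and X :: "nat \<Rightarrow> 'w \<Rightarrow> real"
    and k \<eta> :: real and \<beta> :: "nat \<Rightarrow> real"
  assumes "iid_density_model {1<..} pareto_density Q X"
    and "k > 0"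
    and "\<And>N. N \<ge> 1 \<Longrightarrow> 0 < \<beta> N \<and> \<beta> N < 1"
    and "\<eta> > 0"
    and "(\<lambda>N. inverse (\<beta> N)) \<in> o(\<lambda>N. real N powr (1 - \<eta>))"
  shows "regularizable {1<..} pareto_density Q X k 1 (\<lambda>N. expected_shortfall (\<beta> N))"
proof -
  interpret iid_density_model "{1<..}" pareto_density Q X by fact
  \<comment> \<open>Strictly between \<open>1 - \<eta>\<close> and 1; the maximum with
    \<open>1 / 2\<close> keeps it positive when \<open>\<eta>\<close> is large.\<close>
  define \<delta> where "\<delta> = max (1 / 2) (1 - \<eta> / 2)"
  have \<delta>: "0 < \<delta>" "\<delta> < 1" "1 - \<eta> < \<delta>" using assms(4) by (auto simp: \<delta>_def)
  define r where "r N \<theta> = expected_shortfall (\<beta> N) (distr (Q \<theta>) borel (X 0))" for N \<theta>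
  define T where "T N \<omega> = (\<Sum>i=1..N. ln (X i \<omega>)) / real N" for N \<omega>
  define R where "R N = interior_max_set k (real N) (real N powr \<delta>) (\<beta> N)" for N
  have r: "r N \<theta> = ereal (pareto_es (\<beta> N) (1 / \<theta>))" if "1 \<le> N" "1 < \<theta>" for N \<theta>
  proof -
    have "distr (Q \<theta>) borel (X 0) = distr (Q \<theta>) lborel (X 0)" by (intro distr_cong) auto
    also have "\<dots> = density lborel (\<lambda>x. ennreal (pareto_density x \<theta>))"
      using that by (intro distributed_distr_eq_density distributed_X) simp
    finally show ?thesis
      unfolding r_def using that assms(3)[of N] by (simp add: expected_shortfall_pareto)
  qed
  have "(\<lambda>N. measure (Q \<theta>) {\<omega> \<in> space (Q \<theta>). regular {1<..} pareto_density k 1 \<delta> (r N) N (\<lambda>i. X i \<omega>)})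
      \<longlonglongrightarrow> 1" if "1 < \<theta>" for \<theta>
  proof -
    have "0 < \<theta>" using that by simp
    interpret prob_space "Q \<theta>" using that by (intro prob_space_Q) simp
    have dist: "distributed (Q \<theta>) lborel (X i) (\<lambda>x. ennreal (pareto_density x \<theta>))" for i
      using that by (intro distributed_X) simp
    have [measurable]: "X i \<in> borel_measurable (Q \<theta>)" for i
      using distributed_measurable[OF dist[of i]] by simp
    have ln_dist: "distributed (Q \<theta>) lborel (\<lambda>\<omega>. ln (X i \<omega>)) (exponential_density \<theta>)"
      and gt1: "AE \<omega> in Q \<theta>. 1 < X i \<omega>" for i
      by (rule pareto_imp_ln_exponential[OF \<open>0 < \<theta>\<close> dist])+
    have "indep_vars (\<lambda>_. borel) (\<lambda>i \<omega>. ln (X i \<omega>)) UNIV"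
      using that by (intro indep_vars_compose2[where Y = "\<lambda>_. ln", OF indep_X]) simp_all
    then have ind: "indep_vars (\<lambda>_. borel) (\<lambda>i \<omega>. ln (X i \<omega>)) {1..N}" for N
      by (rule indep_vars_subset) simp
    have [measurable]: "T N \<in> borel_measurable (Q \<theta>)" for N unfolding T_def by measurable
    define E where "E N = {\<omega> \<in> space (Q \<theta>). (\<forall>i\<in>{1..N}. 1 < X i \<omega>) \<and> T N \<omega> \<in> R N}" for N
    \<comment> \<open>An exact equality of sets, with the null event of observations at most 1
      included, so that measurability carries over.\<close>
    have reg: "{\<omega> \<in> space (Q \<theta>). regular {1<..} pareto_density k 1 \<delta> (r N) N (\<lambda>i. X i \<omega>)} = E N"
      if "1 \<le> N" for N
    proof -
      have "regular {1<..} pareto_density k 1 \<delta> (r N) N (\<lambda>i. X i \<omega>) \<longleftrightarrow>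
          (\<forall>i\<in>{1..N}. 1 < X i \<omega>) \<and> T N \<omega> \<in> R N" for \<omega>
        using regular_pareto_iff[of "\<beta> N" k N "\<lambda>i. X i \<omega>" "r N" \<delta>]
          not_regular_outside[of _ N "\<lambda>i. X i \<omega>"] assms(2) assms(3)[OF that] r that
        by (cases "\<forall>i\<in>{1..N}. 1 < X i \<omega>") (auto simp: T_def R_def not_less)
      then show ?thesis by (simp add: E_def)
    qed
    \<comment> \<open>The mean of \<open>ln (X i)\<close> is \<open>1 / \<theta> < 1\<close>;
      \<open>t\<close> is the midpoint between it and 1, and \<open>e\<close> is the margin for
      Chebyshev's inequality.\<close>
    define t where "t = (1 / \<theta> + 1) / 2"
    define e where "e = t - 1 / \<theta>"
    have t: "0 < t" "t < 1" and e: "0 < e" "t = 1 / \<theta> + e"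
      using that by (auto simp: t_def e_def field_simps)
    have "\<forall>\<^sub>F N in sequentially. t \<in> R N"
      unfolding R_def using assms(3) by (intro eventually_mem_interior_max_set[OF assms(2) _ assms(5) \<delta>(3,2) t])
    then have lower: "\<forall>\<^sub>F N in sequentially. 1 - 1 / (\<theta>\<^sup>2 * e\<^sup>2 * real N) \<le> prob (E N)"
      using eventually_ge_at_top[of 1]
    proof eventually_elim
      case (elim N)
      then have b: "0 < \<beta> N" "\<beta> N < 1" using assms(3)[of N] by auto
      have N: "0 < real N" "0 < real N powr \<delta>" using elim by auto
      have [measurable]: "R N \<in> sets borel"
        unfolding R_def using interior_max_set_borel[OF b assms(2) N] .
      have "E N \<in> sets (Q \<theta>)" unfolding E_def by measurable
      moreover have "AE \<omega> in Q \<theta>. \<forall>i\<in>{1..N}. 1 < X i \<omega>"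
        using gt1 by (intro AE_ball_countable') auto
      \<comment> \<open>Since \<open>t\<close> lies in \<open>R N\<close>, downward closure puts
        every positive \<open>T N \<omega> \<le> t\<close> there: a threshold independent of
        \<open>N\<close> replaces the set \<open>R N\<close>.\<close>
      then have "AE \<omega> in Q \<theta>. \<omega> \<in> {\<omega> \<in> space (Q \<theta>). T N \<omega> \<le> t} \<longrightarrow> \<omega> \<in> E N"
      proof eventually_elim
        case X: (elim \<omega>)
        have "0 < (\<Sum>i=1..N. ln (X i \<omega>))" using X elim by (intro sum_pos ln_gt_zero) auto
        then have "0 < T N \<omega>" using N by (simp add: T_def)
        then show ?case
          using X interior_max_set_downward[OF b assms(2) N elim(1)[unfolded R_def]] by (auto simp: E_def R_def)
      qed
      ultimately have "prob {\<omega> \<in> space (Q \<theta>). T N \<omega> \<le> t} \<le> prob (E N)"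
        by (intro finite_measure_mono_AE)
      then show ?case
        using exponential_mean_upper_tail[OF _ _ e(1) ln_dist ind, of N] that elim e(2)
        by (simp add: T_def)
    qed
    have "(\<lambda>N. 1 - 1 / (\<theta>\<^sup>2 * e\<^sup>2) * (1 / real N)) \<longlonglongrightarrow> 1 - 1 / (\<theta>\<^sup>2 * e\<^sup>2) * 0"
      by (intro tendsto_intros lim_1_over_n)
    then have lim: "(\<lambda>N. 1 - 1 / (\<theta>\<^sup>2 * e\<^sup>2 * real N)) \<longlonglongrightarrow> 1"
      by simp
    have "(\<lambda>N. prob (E N)) \<longlonglongrightarrow> 1"
      by (rule tendsto_sandwich[OF lower _ lim tendsto_const]) (simp add: prob_le_1)
    moreover have "\<forall>\<^sub>F N in sequentially. prob (E N) =
        prob {\<omega> \<in> space (Q \<theta>). regular {1<..} pareto_density k 1 \<delta> (r N) N (\<lambda>i. X i \<omega>)}"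
      using eventually_ge_at_top[of 1] by eventually_elim (simp only: reg)
    ultimately show ?thesis by (rule Lim_transform_eventually)
  qed
  then show ?thesis
    unfolding regularizable_def r_def using \<delta> by (intro exI[of _ \<delta>]) simp
qed

end
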